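(* Let $u,v\in\ell^2_{\mathcal G,\omega}$ (real-valued, $\mathcal G$-symmetric sequences). Then $$\mathbb M_u^*=\mathcal O_{\mathcal G}\,\mathbb M_u\,\mathcal O_{\mathcal G}^{-1},\qquad \mathbb M_u^*v=\mathcal O_{\mathcal G}\big(u\star(\mathcal O_{\mathcal G}^{-1}v)\big),\qquad D_u(\mathbb M_u^*v)=\mathbb Q_v,\qquad \mathbb Q_uv=\mathcal O_{\mathcal G}\big((\mathcal O_{\mathcal G}^{-1}u)\star v\big).$$
   Context: $\mathcal G$ is a finite group acting on $\mathbb R^m$ by orthogonal matrices $A_{\mathscr g}$ (no translations), $\mathcal L\in GL_m(\mathbb R)$ is such that $\beta_{\mathscr g}:=\mathcal L^{-1}A_{\mathscr g}^T\mathcal L\in M_m(\mathbb Z)$ for all $\mathscr g$; $\mathcal G$ acts on $\mathbb Z^m$ via the $\beta_{\mathscr g}$, with $\mathrm{orb}_{\mathcal G}(n)=\{\beta_{\mathscr g}n:\mathscr g\in\mathcal G\}$. $\mathcal Z_{\rm red}\subset\mathbb Z^m$ contains exactly one representative of each orbit. For $u=(u_n)_{n\in\mathcal Z_{\rm red}}$, the unfolding $\iota(u)$ on $\mathbb Z^m$ is $\iota(u)_n=u_{n'}$ with $n'\in\mathrm{orb}_{\mathcal G}(n)\cap\mathcal Z_{\rm red}$. Weights $\omega=(\omega_n)_{n\in\mathbb Z^m}$ are admissible: $\omega_n>0$; $\omega_n\le\omega_{n-k}\omega_k$; $\sup_n\sum_k\frac{\omega_n}{\omega_{n-k}\omega_k}<\infty$;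 $\sum_n\frac1{\omega_n}<\infty$. $\ell^2_{\mathcal G,\omega}$ is the space of such $u$ with $\|u\|_{2,\omega}=(\sum_{n\in\mathbb Z^m}|\iota(u)_n|^2\omega_n)^{1/2}<\infty$. All sequences are assumed real-valued: $\iota(u)_{-n}=\overline{\iota(u)_n}$. $u\star v$ is the reduced sequence of the convolution $(\iota(u)\star\iota(v))_n=\sum_{k\in\mathbb Z^m}\iota(u)_{n-k}\iota(v)_k$. $\mathbb M_u$ is the multiplication operator $v\mapsto u\star v$. $\mathcal O_{\mathcal G}$ is the diagonal operator with entries $|\mathrm{orb}_{\mathcal G}(n)|$, $n\in\mathcal Z_{\rm red}$. $\mathbb Q_u:=\mathcal O_{\mathcal G}\mathbb M_{\mathcal O_{\mathcal G}^{-1}u}$. The adjoint $\cdot^*$ is with respect to $(u,v)_2=\sum_{n\in\mathcal Z_{\rm red}}u_n\overline{v_n}$ (no orbit weight), i.e. the conjugate transpose of the matrix indexed by $\mathcal Z_{\rm red}$. $D_u(\mathbb M_u^*v)$ denotes the Fréchet derivative of $u\mapsto\mathbb M_u^*v$ for fixed $v$. *)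

theory Defs
  imports "HOL-Analysis.Analysis" "HOL-Algebra.Group"
begin

text \<open>
  For the lattice basis \<open>L\<close> and the orthogonal matrix \<open>A g\<close>, the matrix
  \<open>\<beta>\<^sub>g = L\<^sup>-\<^sup>1 A\<^sub>g\<^sup>T L\<close> on Fourier indices. It is a real matrix that is assumed to have integer
  entries; \<open>beta_int\<close> is the same matrix read over the integers (the floor is exact under that
  assumption).
\<close>

definition beta :: "('g \<Rightarrow> real^'m^'m) \<Rightarrow> real^'m^'m \<Rightarrow> 'g \<Rightarrow> real^'m^'m"
  where "beta A L g = matrix_inv L ** transpose (A g) ** L"

definition beta_int :: "('g \<Rightarrow> real^'m^'m) \<Rightarrow> real^'m^'m \<Rightarrow> 'g \<Rightarrow> int^'m^'m"
  where "beta_int A L g = (\<chi> i j. \<lfloor>beta A L g $ i $ j\<rfloor>)"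

definition index_orbit ::
    "('g, 'b) monoid_scheme \<Rightarrow> ('g \<Rightarrow> real^'m^'m) \<Rightarrow> real^'m^'m \<Rightarrow> int^'m \<Rightarrow> (int^'m) set"
  where "index_orbit G A L n = {beta_int A L g *v n | g. g \<in> carrier G}"

definition lattice_symmetry ::
    "('g, 'b) monoid_scheme \<Rightarrow> ('g \<Rightarrow> real^'m^'m) \<Rightarrow> real^'m^'m \<Rightarrow> bool"
  where "lattice_symmetry G A L \<longleftrightarrow>
    group G \<and> finite (carrier G) \<and>
    (\<forall>g\<in>carrier G. orthogonal_matrix (A g)) \<and>
    (\<forall>g\<in>carrier G. \<forall>h\<in>carrier G. A (g \<otimes>\<^bsub>G\<^esub> h) = A g ** A h) \<and>
    invertible L \<and>
    (\<forall>g\<in>carrier G. \<forall>i j. beta A L g $ i $ j \<in> \<int>)"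

text \<open>
  From here on \<open>orb\<close> is the orbit map of the index lattice and \<open>Z\<close> the reduced index set.
\<close>

definition reduced_index_set :: "(int^'m \<Rightarrow> (int^'m) set) \<Rightarrow> (int^'m) set \<Rightarrow> bool"
  where "reduced_index_set orb Z \<longleftrightarrow> (\<forall>n. \<exists>!n'. n' \<in> orb n \<inter> Z)"

definition admissible_weights :: "(int^'m \<Rightarrow> real) \<Rightarrow> bool"
  where "admissible_weights \<omega> \<longleftrightarrow>
    (\<forall>n. \<omega> n > 0) \<and>
    (\<forall>n k. \<omega> n \<le> \<omega> (n - k) * \<omega> k) \<and>
    (\<forall>n. (\<lambda>k. \<omega> n / (\<omega> (n - k) * \<omega> k)) summable_on UNIV) \<and>
    bdd_above (range (\<lambda>n. \<Sum>\<^sub>\<infinity>k. \<omega> n / (\<omega> (n - k) * \<omega> k))) \<and>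
    (\<lambda>n. 1 / \<omega> n) summable_on UNIV"

text \<open>
  A sequence indexed by \<open>Z\<close> is encoded as a function on the whole index lattice that vanishes off
  \<open>Z\<close>; \<open>restrict_to\<close> produces such functions.
\<close>

definition restrict_to :: "(int^'m) set \<Rightarrow> (int^'m \<Rightarrow> complex) \<Rightarrow> int^'m \<Rightarrow> complex"
  where "restrict_to Z a = (\<lambda>n. if n \<in> Z then a n else 0)"

definition unfolding_seq ::
    "(int^'m \<Rightarrow> (int^'m) set) \<Rightarrow> (int^'m) set \<Rightarrow> (int^'m \<Rightarrow> complex) \<Rightarrow> int^'m \<Rightarrow> complex"
  where "unfolding_seq orb Z u = (\<lambda>n. u (THE n'. n' \<in> orb n \<inter> Z))"

definition ell2 ::
    "(int^'m \<Rightarrow> (int^'m) set) \<Rightarrow> (int^'m) set \<Rightarrow> (int^'m \<Rightarrow> real) \<Rightarrow> (int^'m \<Rightarrow> complex) set"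
  where "ell2 orb Z \<omega> =
    {u. (\<forall>n. n \<notin> Z \<longrightarrow> u n = 0) \<and>
        (\<lambda>n. (cmod (unfolding_seq orb Z u n))\<^sup>2 * \<omega> n) summable_on UNIV}"

definition ell2_norm ::
    "(int^'m \<Rightarrow> (int^'m) set) \<Rightarrow> (int^'m) set \<Rightarrow> (int^'m \<Rightarrow> real) \<Rightarrow> (int^'m \<Rightarrow> complex) \<Rightarrow> real"
  where "ell2_norm orb Z \<omega> u = sqrt (\<Sum>\<^sub>\<infinity>n. (cmod (unfolding_seq orb Z u n))\<^sup>2 * \<omega> n)"

text \<open>
  Sequences are Fourier coefficients, and ``real-valued'' refers to the function they represent:
  the coefficients themselves are complex with conjugate symmetry. These sequences form a real,
  not a complex, subspace of \<open>ell2\<close>.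
\<close>

definition ell2_real ::
    "(int^'m \<Rightarrow> (int^'m) set) \<Rightarrow> (int^'m) set \<Rightarrow> (int^'m \<Rightarrow> real) \<Rightarrow> (int^'m \<Rightarrow> complex) set"
  where "ell2_real orb Z \<omega> =
    {u \<in> ell2 orb Z \<omega>. \<forall>n. unfolding_seq orb Z u (- n) = cnj (unfolding_seq orb Z u n)}"

definition convolution :: "(int^'m \<Rightarrow> complex) \<Rightarrow> (int^'m \<Rightarrow> complex) \<Rightarrow> int^'m \<Rightarrow> complex"
  where "convolution a b = (\<lambda>n. \<Sum>\<^sub>\<infinity>k. a (n - k) * b k)"

definition reduced_conv ::
    "(int^'m \<Rightarrow> (int^'m) set) \<Rightarrow> (int^'m) set \<Rightarrow>
     (int^'m \<Rightarrow> complex) \<Rightarrow> (int^'m \<Rightarrow> complex) \<Rightarrow> int^'m \<Rightarrow> complex"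
  where "reduced_conv orb Z u v =
    restrict_to Z (convolution (unfolding_seq orb Z u) (unfolding_seq orb Z v))"

definition mult_op ::
    "(int^'m \<Rightarrow> (int^'m) set) \<Rightarrow> (int^'m) set \<Rightarrow>
     (int^'m \<Rightarrow> complex) \<Rightarrow> (int^'m \<Rightarrow> complex) \<Rightarrow> int^'m \<Rightarrow> complex"
  where "mult_op orb Z u = (\<lambda>v. reduced_conv orb Z u v)"

text \<open>
  \<open>orbit_op\<close> is a bijection of the full function space as soon as all orbits are finite and
  nonempty, and its inverse preserves vanishing off \<open>Z\<close>. The inverse function is written
  \<open>inv_into UNIV\<close> because the imported group theory reserves the notation \<open>inv\<close>.
\<close>

definition orbit_op :: "(int^'m \<Rightarrow> (int^'m) set) \<Rightarrow> (int^'m \<Rightarrow> complex) \<Rightarrow> int^'m \<Rightarrow> complex"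
  where "orbit_op orb u = (\<lambda>n. of_nat (card (orb n)) * u n)"

definition orbit_op_inv ::
    "(int^'m \<Rightarrow> (int^'m) set) \<Rightarrow> (int^'m \<Rightarrow> complex) \<Rightarrow> int^'m \<Rightarrow> complex"
  where "orbit_op_inv orb = inv_into UNIV (orbit_op orb)"

definition Q_op ::
    "(int^'m \<Rightarrow> (int^'m) set) \<Rightarrow> (int^'m) set \<Rightarrow>
     (int^'m \<Rightarrow> complex) \<Rightarrow> (int^'m \<Rightarrow> complex) \<Rightarrow> int^'m \<Rightarrow> complex"
  where "Q_op orb Z u = orbit_op orb \<circ> mult_op orb Z (orbit_op_inv orb u)"

definition inner2 :: "(int^'m) set \<Rightarrow> (int^'m \<Rightarrow> complex) \<Rightarrow> (int^'m \<Rightarrow> complex) \<Rightarrow> complex"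
  where "inner2 Z u v = (\<Sum>\<^sub>\<infinity>n\<in>Z. u n * cnj (v n))"

text \<open>
  The adjoint with respect to the unweighted product \<open>inner2\<close>. Since \<open>ell2\<close> contains the unit
  sequences, taking \<open>x\<close> to be the unit sequence at \<open>n\<close> determines the \<open>n\<close>-th entry of the adjoint
  and shows that its matrix is the conjugate transpose of that of \<open>T\<close>.
\<close>

definition adjoint_op ::
    "(int^'m \<Rightarrow> (int^'m) set) \<Rightarrow> (int^'m) set \<Rightarrow> (int^'m \<Rightarrow> real) \<Rightarrow>
     ((int^'m \<Rightarrow> complex) \<Rightarrow> (int^'m \<Rightarrow> complex)) \<Rightarrow> (int^'m \<Rightarrow> complex) \<Rightarrow> int^'m \<Rightarrow> complex"
  where "adjoint_op orb Z \<omega> T y =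
    (THE z. z \<in> ell2 orb Z \<omega> \<and>
            (\<forall>x \<in> ell2 orb Z \<omega>. inner2 Z (T x) y = inner2 Z x z))"

text \<open>
  Frechet differentiability on a real subspace \<open>X\<close> of functions that is normed by \<open>N\<close>. The library
  notion \<open>has_derivative\<close> is unavailable because the space depends on term parameters and hence is
  not a type.
\<close>

definition has_frechet_derivative_on ::
    "('a \<Rightarrow> complex) set \<Rightarrow> (('a \<Rightarrow> complex) \<Rightarrow> real) \<Rightarrow>
     (('a \<Rightarrow> complex) \<Rightarrow> 'a \<Rightarrow> complex) \<Rightarrow> (('a \<Rightarrow> complex) \<Rightarrow> 'a \<Rightarrow> complex) \<Rightarrow>
     ('a \<Rightarrow> complex) \<Rightarrow> bool"
  where "has_frechet_derivative_on X N F D u \<longleftrightarrow>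
    u \<in> X \<and> F ` X \<subseteq> X \<and> D ` X \<subseteq> X \<and>
    (\<forall>h\<in>X. \<forall>k\<in>X. D (\<lambda>n. h n + k n) = (\<lambda>n. D h n + D k n)) \<and>
    (\<forall>r::real. \<forall>h\<in>X. D (\<lambda>n. of_real r * h n) = (\<lambda>n. of_real r * D h n)) \<and>
    (\<exists>C. \<forall>h\<in>X. N (D h) \<le> C * N h) \<and>
    (\<forall>\<epsilon>>0. \<exists>\<delta>>0. \<forall>h\<in>X. N h < \<delta> \<longrightarrow>
       N (\<lambda>n. F (\<lambda>k. u k + h k) n - F u n - D h n) \<le> \<epsilon> * N h)"

end

theory Submission
  imports Defs
begin

text \<open>
  The conditions on the weights make the weighted sequences a Banach algebra under convolution
  (Cauchy--Schwarz with the kernel \<open>\<omega> n / (\<omega> (n - k) * \<omega> k)\<close>) that embeds into the absolutely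
  summable sequences, so double sums may be reordered. On the full lattice, convolution with a
  conjugate symmetric sequence is self-adjoint. The sum of an invariant sequence over the lattice is
  its sum over \<open>Z\<close> weighted by orbit sizes, so passing to the unweighted product on \<open>Z\<close> conjugates
  the multiplication operator by the orbit sizes. By commutativity of convolution the adjoint applied
  to a fixed sequence is linear in the multiplier, hence is its own derivative.
\<close>

section \<open>Weighted sequences and convolution\<close>

text \<open>Embeds weighted l2 into l1. With t = |a n| * w n, the inequality t <= t^2 + 1 divided by
  \<open>w n\<close> bounds |a n| by two summable terms.\<close>

lemma summable_square_bound:
  fixes a w :: "'a \<Rightarrow> real"
  assumes pos: "\<And>n. w n > 0"
    and a: "(\<lambda>n. (a n)\<^sup>2 * w n) summable_on UNIV"
    and w: "(\<lambda>n. 1 / w n) summable_on UNIV"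
  shows "(\<lambda>n. \<bar>a n\<bar>) summable_on UNIV"
proof (rule summable_on_comparison_test)
  show "(\<lambda>n. (a n)\<^sup>2 * w n + 1 / w n) summable_on UNIV"
    by (intro summable_on_add a w)
  show "\<bar>a n\<bar> \<le> (a n)\<^sup>2 * w n + 1 / w n" for n
  proof -
    have "0 \<le> (\<bar>a n\<bar> * w n - 1)\<^sup>2" by simp
    then have "2 * \<bar>a n\<bar> * w n \<le> (a n)\<^sup>2 * w n * w n + 1"
      by (simp add: power2_eq_square algebra_simps)
    moreover have "0 \<le> \<bar>a n\<bar> * w n" using pos[of n] by simp
    ultimately have "\<bar>a n\<bar> * w n \<le> (a n)\<^sup>2 * w n * w n + 1" by linarith
    then show ?thesis using pos[of n] by (simp add: field_simps)
  qed
qed simp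

text \<open>Each finite partial sum obeys the finite inequality, whose right side is at most the
  product of the full l2 norms; a bound uniform in the finite set passes to the infinite
  sum.\<close>

lemma Cauchy_Schwarz_infsum:
  fixes f g :: "'a \<Rightarrow> real"
  assumes f: "(\<lambda>k. (f k)\<^sup>2) summable_on A" and g: "(\<lambda>k. (g k)\<^sup>2) summable_on A"
    and fg: "(\<lambda>k. \<bar>f k\<bar> * \<bar>g k\<bar>) summable_on A"
  shows "(\<Sum>\<^sub>\<infinity>k\<in>A. \<bar>f k\<bar> * \<bar>g k\<bar>)\<^sup>2 \<le> (\<Sum>\<^sub>\<infinity>k\<in>A. (f k)\<^sup>2) * (\<Sum>\<^sub>\<infinity>k\<in>A. (g k)\<^sup>2)"
proof -
  have "(\<Sum>\<^sub>\<infinity>k\<in>A. \<bar>f k\<bar> * \<bar>g k\<bar>) \<le> sqrt (\<Sum>\<^sub>\<infinity>k\<in>A. (f k)\<^sup>2) * sqrt (\<Sum>\<^sub>\<infinity>k\<in>A. (g k)\<^sup>2)"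
  proof (rule infsum_le_finite_sums[OF fg])
    fix F assume F: "finite F" "F \<subseteq> A"
    have "(\<Sum>k\<in>F. \<bar>f k\<bar> * \<bar>g k\<bar>) \<le> L2_set f F * L2_set g F"
      by (rule L2_set_mult_ineq)
    also have "\<dots> \<le> sqrt (\<Sum>\<^sub>\<infinity>k\<in>A. (f k)\<^sup>2) * sqrt (\<Sum>\<^sub>\<infinity>k\<in>A. (g k)\<^sup>2)"
      unfolding L2_set_def using F f g
      by (intro mult_mono real_sqrt_le_mono finite_sum_le_infsum)
        (auto intro: sum_nonneg infsum_nonneg)
    finally show "(\<Sum>k\<in>F. \<bar>f k\<bar> * \<bar>g k\<bar>) \<le> \<dots>" .
  qed
  then have "(\<Sum>\<^sub>\<infinity>k\<in>A. \<bar>f k\<bar> * \<bar>g k\<bar>)\<^sup>2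
      \<le> (sqrt (\<Sum>\<^sub>\<infinity>k\<in>A. (f k)\<^sup>2) * sqrt (\<Sum>\<^sub>\<infinity>k\<in>A. (g k)\<^sup>2))\<^sup>2"
    by (intro power_mono infsum_nonneg) auto
  then show ?thesis by (simp add: power_mult_distrib infsum_nonneg)
qed

text \<open>Tonelli for convolutions: for fixed \<open>k\<close>, translation invariance gives the
  sum \<open>S * g k\<close> over \<open>n\<close>. Nonnegativity turns iterated summability into
  joint summability. Applied both to moduli and to weighted squares.\<close>

lemma has_sum_shifted_product:
  fixes f g :: "'a::ab_group_add \<Rightarrow> real"
  assumes f: "(f has_sum S) UNIV" and g: "(g has_sum T) UNIV"
    and nonneg: "\<And>n. f n \<ge> 0" "\<And>n. g n \<ge> 0"
  shows "((\<lambda>(n, k). f (n - k) * g k) has_sum S * T) (UNIV \<times> UNIV)"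
proof (subst has_sum_swap, rule has_sum_SigmaI)
  have fk: "((\<lambda>n. f (n - k)) has_sum S) UNIV" for k
  proof -
    have "bij_betw (\<lambda>n. n - k) UNIV UNIV"
      by (rule bij_betwI[where g = "\<lambda>n. n + k"]) auto
    from has_sum_reindex_bij_betw[OF this, of f S] f show ?thesis by simp
  qed
  show *: "((\<lambda>n. case (k, n) of (k, n) \<Rightarrow> case (n, k) of (n, k) \<Rightarrow> f (n - k) * g k) has_sum S * g k) UNIV"
    for k by (simp add: has_sum_cmult_left[OF fk])
  show "((\<lambda>k. S * g k) has_sum S * T) UNIV"
    by (rule has_sum_cmult_right[OF g])
  then show "(\<lambda>(k, n). case (n, k) of (n, k) \<Rightarrow> f (n - k) * g k) summable_on UNIV \<times> UNIV"
    by (intro summable_on_SigmaI[OF *]) (auto simp: nonneg summable_on_def)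
qed

section \<open>Weighted l2 on an arbitrary index set\<close>

text \<open>Counterpart of \<open>ell2\<close> without orbits or a reduced set, so that the analytic
  estimates can be proved before any symmetry enters.\<close>

definition weighted_l2 :: "('a \<Rightarrow> real) \<Rightarrow> ('a \<Rightarrow> complex) set"
  where "weighted_l2 w = {a. (\<lambda>n. (cmod (a n))\<^sup>2 * w n) summable_on UNIV}"

definition weighted_norm :: "('a \<Rightarrow> real) \<Rightarrow> ('a \<Rightarrow> complex) \<Rightarrow> real"
  where "weighted_norm w a = sqrt (\<Sum>\<^sub>\<infinity>n. (cmod (a n))\<^sup>2 * w n)"

text \<open>Serves to bound the orbit operator and its inverse, whose unfoldings are pointwise
  multiples of the original ones with bounded factors.\<close>

lemma weighted_l2_dominated:
  assumes w: "\<And>n. w n \<ge> 0" and c: "c \<ge> 0"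
    and a: "a \<in> weighted_l2 w" and b: "\<And>n. cmod (b n) \<le> c * cmod (a n)"
  shows "b \<in> weighted_l2 w" and "weighted_norm w b \<le> c * weighted_norm w a"
proof -
  let ?A = "\<lambda>n. (cmod (a n))\<^sup>2 * w n" and ?B = "\<lambda>n. (cmod (b n))\<^sup>2 * w n"
  have A: "?A summable_on UNIV" using a by (simp add: weighted_l2_def)
  have le: "?B n \<le> c\<^sup>2 * ?A n" for n
  proof -
    have "(cmod (b n))\<^sup>2 \<le> (c * cmod (a n))\<^sup>2"
      by (intro power_mono b) simp
    from mult_right_mono[OF this w[of n]] show ?thesis
      by (simp add: power_mult_distrib mult.assoc)
  qed
  have B: "?B summable_on UNIV"
    by (rule summable_on_comparison_test[OF summable_on_cmult_right[OF A] le])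
      (simp add: w)
  then show "b \<in> weighted_l2 w" by (simp add: weighted_l2_def)
  have "(\<Sum>\<^sub>\<infinity>n. ?B n) \<le> (\<Sum>\<^sub>\<infinity>n. c\<^sup>2 * ?A n)"
    by (intro infsum_mono B summable_on_cmult_right A le)
  also have "\<dots> = c\<^sup>2 * (\<Sum>\<^sub>\<infinity>n. ?A n)"
    by (rule infsum_cmult_right) (rule A)
  finally have "weighted_norm w b \<le> sqrt (c\<^sup>2 * (\<Sum>\<^sub>\<infinity>n. ?A n))"
    unfolding weighted_norm_def by (rule real_sqrt_le_mono)
  then show "weighted_norm w b \<le> c * weighted_norm w a"
    using c by (simp add: weighted_norm_def real_sqrt_mult)
qed

text \<open>The pointwise bound |x + y|^2 <= 2|x|^2 + 2|y|^2 suffices for closure under addition; no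
  Minkowski inequality is involved.\<close>

lemma weighted_l2_add:
  assumes w: "\<And>n. w n \<ge> 0" and a: "a \<in> weighted_l2 w" and b: "b \<in> weighted_l2 w"
  shows "(\<lambda>n. a n + b n) \<in> weighted_l2 w"
proof -
  let ?s = "\<lambda>n. 2 * ((cmod (a n))\<^sup>2 * w n) + 2 * ((cmod (b n))\<^sup>2 * w n)"
  have "?s summable_on UNIV"
    using a b by (intro summable_on_add summable_on_cmult_right) (auto simp: weighted_l2_def)
  then show ?thesis unfolding weighted_l2_def mem_Collect_eq
  proof (rule summable_on_comparison_test)
    fix n
    have "(cmod (a n + b n))\<^sup>2 \<le> (cmod (a n) + cmod (b n))\<^sup>2"
      by (intro power_mono norm_triangle_ineq) simp
    also have "\<dots> \<le> 2 * (cmod (a n))\<^sup>2 + 2 * (cmod (b n))\<^sup>2"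
      using sum_squares_bound[of "cmod (a n)" "cmod (b n)"]
      by (simp add: power2_sum)
    finally show "(cmod (a n + b n))\<^sup>2 * w n \<le> ?s n"
      using mult_right_mono[OF _ w[of n], of _ "2 * (cmod (a n))\<^sup>2 + 2 * (cmod (b n))\<^sup>2"]
      by (simp add: distrib_right mult.assoc)
  qed (simp add: w)
qed

section \<open>Algebraic properties of convolution\<close>

lemma convolution_commute:
  fixes a b :: "int^'m \<Rightarrow> complex"
  shows "convolution a b = convolution b a"
proof
  fix n :: "int^'m"
  have "bij_betw (\<lambda>k. n - k) UNIV UNIV"
    by (rule bij_betwI[where g = "\<lambda>k. n - k"]) (auto simp: algebra_simps)
  from infsum_reindex_bij_betw[OF this, of "\<lambda>k. a (n - k) * b k"]
  show "convolution a b n = convolution b a n"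
    by (simp add: convolution_def mult.commute)
qed

text \<open>A nonzero factor also preserves divergence, so the default value 0 of a divergent sum is
  consistent on both sides.\<close>

lemma convolution_cmult_right: "convolution a (\<lambda>n. c * b n) = (\<lambda>n. c * convolution a b n)"
  by (simp add: convolution_def mult.left_commute infsum_cmult_right')

text \<open>The product of real functions is real, on the Fourier side: substitute -k for k and
  conjugate termwise.\<close>

lemma convolution_reflect:
  fixes a b :: "int^'m \<Rightarrow> complex"
  assumes "\<And>n. a (- n) = cnj (a n)" "\<And>n. b (- n) = cnj (b n)"
  shows "convolution a b (- n) = cnj (convolution a b n)"
proof -
  have "bij_betw uminus UNIV (UNIV :: (int^'m) set)"
    by (rule bij_betwI[where g = uminus]) auto
  from infsum_reindex_bij_betw[OF this, of "\<lambda>k. a (- n - k) * b k"]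
  have "convolution a b (- n) = (\<Sum>\<^sub>\<infinity>k. a (- n - (- k)) * b (- k))"
    unfolding convolution_def by (rule sym)
  also have "\<dots> = (\<Sum>\<^sub>\<infinity>k. cnj (a (n - k) * b k))"
  proof (rule infsum_cong)
    show "a (- n - (- k)) * b (- k) = cnj (a (n - k) * b k)" for k
      using assms(1)[of "n - k"] assms(2)[of k] by simp
  qed
  also have "\<dots> = cnj (convolution a b n)"
    unfolding convolution_def by (rule infsum_cnj)
  finally show ?thesis .
qed

text \<open>Conjugate symmetry turns \<open>a (n - k)\<close> into the conjugate of
  \<open>a (k - n)\<close>, so the kernel equals its own adjoint. The double family is dominated by
  \<open>K\<close> times an l1 product, which permits exchanging the sums. The first conclusion
  later allows regrouping by orbits.\<close>

lemma convolution_self_adjoint: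
  fixes a b c :: "int^'m \<Rightarrow> complex"
  assumes a: "(\<lambda>n. cmod (a n)) summable_on UNIV" and b: "(\<lambda>n. cmod (b n)) summable_on UNIV"
    and sym: "\<And>n. a (- n) = cnj (a n)" and c: "\<And>n. cmod (c n) \<le> K"
  shows "(\<lambda>n. cmod (convolution a b n * cnj (c n))) summable_on UNIV"
    and "(\<Sum>\<^sub>\<infinity>n. convolution a b n * cnj (c n)) = (\<Sum>\<^sub>\<infinity>n. b n * cnj (convolution a c n))"
proof -
  let ?f = "\<lambda>(n, k). a (n - k) * b k * cnj (c n)"
  have prod: "(\<lambda>(n, k). cmod (a (n - k)) * cmod (b k)) summable_on UNIV \<times> UNIV"
    using has_sum_shifted_product[OF has_sum_infsum[OF a] has_sum_infsum[OF b]]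
    by (auto simp: summable_on_def)
  have abs: "(\<lambda>x. cmod (?f x)) summable_on UNIV \<times> UNIV"
    by (rule Infinite_Sum.abs_summable_on_comparison_test'[OF summable_on_cmult_right[OF prod, of K]])
      (auto simp: norm_mult mult.commute[of K] intro!: mult_left_mono c)
  have row: "(\<Sum>\<^sub>\<infinity>k. ?f (n, k)) = convolution a b n * cnj (c n)" for n
    unfolding convolution_def by (simp add: infsum_cmult_left')
  have "(\<lambda>n. \<Sum>\<^sub>\<infinity>k. cmod (?f (n, k))) summable_on UNIV"
    using abs by (intro summable_on_Sigma_banach) (simp add: case_prod_unfold)
  then show "(\<lambda>n. cmod (convolution a b n * cnj (c n))) summable_on UNIV"
  proof (rule Infinite_Sum.abs_summable_on_comparison_test')
    fix n
    have "(\<lambda>k. cmod (?f (n, k))) summable_on UNIV"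
      using abs unfolding Infinite_Sum.abs_summable_on_Sigma_iff by simp
    then show "cmod (convolution a b n * cnj (c n)) \<le> (\<Sum>\<^sub>\<infinity>k. cmod (?f (n, k)))"
      unfolding row[symmetric] by (rule norm_infsum_bound)
  qed
  have "(\<Sum>\<^sub>\<infinity>n. convolution a b n * cnj (c n)) = (\<Sum>\<^sub>\<infinity>n. \<Sum>\<^sub>\<infinity>k. a (n - k) * b k * cnj (c n))"
    unfolding row[symmetric] by simp
  also have "\<dots> = (\<Sum>\<^sub>\<infinity>k. \<Sum>\<^sub>\<infinity>n. a (n - k) * b k * cnj (c n))"
    by (rule infsum_swap_banach) (rule Infinite_Sum.abs_summable_summable[OF abs])
  also have "\<dots> = (\<Sum>\<^sub>\<infinity>k. b k * cnj (convolution a c k))"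
  proof (rule infsum_cong)
    fix k
    have "a (n - k) * b k * cnj (c n) = b k * cnj (a (k - n) * c n)" for n
      using sym[of "k - n"] by (simp add: mult.assoc mult.left_commute)
    then have "(\<Sum>\<^sub>\<infinity>n. a (n - k) * b k * cnj (c n)) = (\<Sum>\<^sub>\<infinity>n. b k * cnj (a (k - n) * c n))"
      by (rule infsum_cong)
    also have "\<dots> = b k * cnj (convolution a c k)"
      unfolding convolution_def by (simp only: infsum_cmult_right' infsum_cnj)
    finally show "(\<Sum>\<^sub>\<infinity>n. a (n - k) * b k * cnj (c n)) = b k * cnj (convolution a c k)" .
  qed
  finally show "(\<Sum>\<^sub>\<infinity>n. convolution a b n * cnj (c n)) = (\<Sum>\<^sub>\<infinity>n. b n * cnj (convolution a c n))" .
qed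

section \<open>The convolution algebra of admissible weights\<close>

locale admissible =
  fixes \<omega> :: "int^'m \<Rightarrow> real"
  assumes admissible: "admissible_weights \<omega>"
begin

lemma weight_pos: "\<omega> n > 0"
  using admissible by (simp add: admissible_weights_def)

lemma weight_nonneg: "\<omega> n \<ge> 0"
  using weight_pos[of n] by simp

lemma weighted_l2_abs_summable:
  assumes "a \<in> weighted_l2 \<omega>"
  shows "(\<lambda>n. cmod (a n)) summable_on UNIV"
  using summable_square_bound[of \<omega> "\<lambda>n. cmod (a n)"] assms admissible
  by (simp add: weighted_l2_def admissible_weights_def)

lemma weighted_l2_bounded:
  assumes "a \<in> weighted_l2 \<omega>"
  obtains K where "\<And>n. cmod (a n) \<le> K"
proof
  show "cmod (a n) \<le> (\<Sum>\<^sub>\<infinity>n. cmod (a n))" for n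
    using finite_sum_le_infsum[OF weighted_l2_abs_summable[OF assms], of "{n}"] by simp
qed

lemma convolution_abs_summable:
  assumes a: "a \<in> weighted_l2 \<omega>" and b: "b \<in> weighted_l2 \<omega>"
  shows "(\<lambda>k. cmod (a (n - k) * b k)) summable_on UNIV"
proof -
  obtain K where "\<And>n. cmod (a n) \<le> K" using weighted_l2_bounded[OF a] by blast
  then show ?thesis
    by (intro Infinite_Sum.abs_summable_on_comparison_test'
        [OF summable_on_cmult_right[OF weighted_l2_abs_summable[OF b], of K]])
      (auto simp: norm_mult intro!: mult_right_mono)
qed

lemma convolution_add_right:
  assumes "a \<in> weighted_l2 \<omega>" "b \<in> weighted_l2 \<omega>" "c \<in> weighted_l2 \<omega>"
  shows "convolution a (\<lambda>n. b n + c n) = (\<lambda>n. convolution a b n + convolution a c n)"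
  unfolding convolution_def distrib_left
  using Infinite_Sum.abs_summable_summable[OF convolution_abs_summable[OF assms(1,2)]]
    Infinite_Sum.abs_summable_summable[OF convolution_abs_summable[OF assms(1,3)]]
  by (intro ext infsum_add)

text \<open>The constant is the square root of a bound on the kernel sums. Cauchy-Schwarz in
  \<open>k\<close> separates the kernel from the weighted squares, and Tonelli then sums the squares
  over \<open>n\<close>. Uniformity in both factors is what later bounds the derivative.\<close>

lemma ex_convolution_bound:
  obtains C where "C \<ge> 0"
    and "\<And>a b. a \<in> weighted_l2 \<omega> \<Longrightarrow> b \<in> weighted_l2 \<omega> \<Longrightarrow> convolution a b \<in> weighted_l2 \<omega> \<and>
      weighted_norm \<omega> (convolution a b) \<le> C * weighted_norm \<omega> a * weighted_norm \<omega> b"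
proof -
  let ?r = "\<lambda>n k. \<omega> n / (\<omega> (n - k) * \<omega> k)"
  from admissible have r: "?r n summable_on UNIV" for n
    by (simp add: admissible_weights_def)
  from admissible obtain C where C: "(\<Sum>\<^sub>\<infinity>k. ?r n k) \<le> C" for n
    unfolding admissible_weights_def bdd_above_def by auto
  have "0 \<le> (\<Sum>\<^sub>\<infinity>k. ?r 0 k)" by (intro infsum_nonneg) (simp add: weight_nonneg)
  then have C0: "C \<ge> 0" using C[of 0] by linarith
  show thesis
  proof (rule that[of "sqrt C"])
    show "sqrt C \<ge> 0" using C0 by simp
  next
    fix a b assume a: "a \<in> weighted_l2 \<omega>" and b: "b \<in> weighted_l2 \<omega>"
    let ?A = "\<lambda>n. (cmod (a n))\<^sup>2 * \<omega> n" and ?B = "\<lambda>n. (cmod (b n))\<^sup>2 * \<omega> n"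
    let ?F = "\<lambda>n k. ?A (n - k) * ?B k"
    have F: "((\<lambda>(n, k). ?F n k) has_sum (\<Sum>\<^sub>\<infinity>n. ?A n) * (\<Sum>\<^sub>\<infinity>n. ?B n)) (UNIV \<times> UNIV)"
      using a b
      by (intro has_sum_shifted_product has_sum_infsum)
        (auto simp: weighted_l2_def weight_nonneg)
    then have Fs: "(\<lambda>(n, k). ?F n k) summable_on UNIV \<times> UNIV"
      by (auto simp: summable_on_def)
    have row: "(cmod (convolution a b n))\<^sup>2 * \<omega> n \<le> C * (\<Sum>\<^sub>\<infinity>k. ?F n k)" for n
    proof -
      \<comment> \<open>The product of \<open>?f\<close> and \<open>?g\<close> is the modulus of the
        convolution term. The weight at \<open>n\<close>, multiplied back in afterwards, turns the
        square of \<open>?g\<close> into the admissibility kernel \<open>?r n k\<close>.\<close>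
      let ?f = "\<lambda>k. sqrt (?F n k)" and ?g = "\<lambda>k. sqrt (1 / (\<omega> (n - k) * \<omega> k))"
      have f2: "(?f k)\<^sup>2 = ?F n k" for k by (simp add: weight_nonneg)
      have g2: "(?g k)\<^sup>2 = ?r n k * inverse (\<omega> n)" for k
        using weight_pos[of n] by (simp add: weight_nonneg)
      have fg: "\<bar>?f k\<bar> * \<bar>?g k\<bar> = cmod (a (n - k) * b k)" for k
      proof -
        have "\<bar>?f k\<bar> * \<bar>?g k\<bar> = ?f k * ?g k" by (simp add: weight_nonneg)
        also have "\<dots> = sqrt (?F n k * (1 / (\<omega> (n - k) * \<omega> k)))"
          by (rule real_sqrt_mult[symmetric])
        also have "?F n k * (1 / (\<omega> (n - k) * \<omega> k)) = (cmod (a (n - k) * b k))\<^sup>2"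
          using weight_pos[of "n - k"] weight_pos[of k]
          by (simp add: norm_mult power_mult_distrib)
        finally show ?thesis by simp
      qed
      have "cmod (convolution a b n) \<le> (\<Sum>\<^sub>\<infinity>k. cmod (a (n - k) * b k))"
        unfolding convolution_def
        by (intro norm_infsum_bound convolution_abs_summable a b)
      then have "(cmod (convolution a b n))\<^sup>2 \<le> (\<Sum>\<^sub>\<infinity>k. \<bar>?f k\<bar> * \<bar>?g k\<bar>)\<^sup>2"
        unfolding fg by (intro power_mono) auto
      also have "\<dots> \<le> (\<Sum>\<^sub>\<infinity>k. (?f k)\<^sup>2) * (\<Sum>\<^sub>\<infinity>k. (?g k)\<^sup>2)"
      proof (rule Cauchy_Schwarz_infsum)
        show "(\<lambda>k. (?f k)\<^sup>2) summable_on UNIV"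
          unfolding f2 by (rule summable_on_SigmaD1[OF Fs]) simp
        show "(\<lambda>k. (?g k)\<^sup>2) summable_on UNIV"
          unfolding g2 by (rule summable_on_cmult_left[OF r])
        show "(\<lambda>k. \<bar>?f k\<bar> * \<bar>?g k\<bar>) summable_on UNIV"
          unfolding fg by (rule convolution_abs_summable[OF a b])
      qed
      also have "(\<Sum>\<^sub>\<infinity>k. (?g k)\<^sup>2) = (\<Sum>\<^sub>\<infinity>k. ?r n k) * inverse (\<omega> n)"
        unfolding g2 by (rule infsum_cmult_left[OF r])
      finally have "(cmod (convolution a b n))\<^sup>2 * \<omega> n \<le> (\<Sum>\<^sub>\<infinity>k. ?F n k) * (\<Sum>\<^sub>\<infinity>k. ?r n k)"
        unfolding f2 using weight_pos[of n] by (simp add: field_simps)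
      also have "\<dots> \<le> (\<Sum>\<^sub>\<infinity>k. ?F n k) * C"
        by (intro mult_left_mono C infsum_nonneg) (simp add: weight_nonneg)
      finally show ?thesis by (simp add: mult.commute)
    qed
    have FC: "(\<lambda>n. C * (\<Sum>\<^sub>\<infinity>k. ?F n k)) summable_on UNIV"
      by (intro summable_on_cmult_right summable_on_Sigma_banach Fs)
    have conv: "(\<lambda>n. (cmod (convolution a b n))\<^sup>2 * \<omega> n) summable_on UNIV"
      by (rule summable_on_comparison_test[OF FC row]) (simp add: weight_nonneg)
    have "(\<Sum>\<^sub>\<infinity>n. (cmod (convolution a b n))\<^sup>2 * \<omega> n) \<le> (\<Sum>\<^sub>\<infinity>n. C * (\<Sum>\<^sub>\<infinity>k. ?F n k))"
      by (intro infsum_mono conv FC row)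
    also have "\<dots> = C * (\<Sum>\<^sub>\<infinity>n. \<Sum>\<^sub>\<infinity>k. ?F n k)"
      by (rule infsum_cmult_right')
    also have "(\<Sum>\<^sub>\<infinity>n. \<Sum>\<^sub>\<infinity>k. ?F n k) = (\<Sum>\<^sub>\<infinity>n. ?A n) * (\<Sum>\<^sub>\<infinity>n. ?B n)"
      using infsum_Sigma'_banach[OF Fs] infsumI[OF F] by simp
    finally have "weighted_norm \<omega> (convolution a b) \<le> sqrt (C * ((\<Sum>\<^sub>\<infinity>n. ?A n) * (\<Sum>\<^sub>\<infinity>n. ?B n)))"
      unfolding weighted_norm_def by (rule real_sqrt_le_mono)
    also have "\<dots> = sqrt C * weighted_norm \<omega> a * weighted_norm \<omega> b"
      by (simp add: weighted_norm_def real_sqrt_mult)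
    finally show "convolution a b \<in> weighted_l2 \<omega> \<and>
      weighted_norm \<omega> (convolution a b) \<le> sqrt C * weighted_norm \<omega> a * weighted_norm \<omega> b"
      using conv by (simp add: weighted_l2_def)
  qed
qed

lemma convolution_weighted_l2:
  "a \<in> weighted_l2 \<omega> \<Longrightarrow> b \<in> weighted_l2 \<omega> \<Longrightarrow> convolution a b \<in> weighted_l2 \<omega>"
  using ex_convolution_bound by metis

end

section \<open>Sequences invariant under a finite group\<close>

text \<open>Orbits depend only on the set of maps by which the group acts, so the group is replaced
  by a finite set of additive bijections closed under composition and inverses. This also hides that
  the matrices multiply in reversed order.\<close>

locale orbit_action = admissible \<omega> for \<omega> :: "int^'m \<Rightarrow> real" +
  fixes B :: "(int^'m \<Rightarrow> int^'m) set"
    and orb :: "int^'m \<Rightarrow> (int^'m) set"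
    and Z :: "(int^'m) set"
  assumes finite_B: "finite B"
    and id_B: "id \<in> B"
    and comp_B: "f \<in> B \<Longrightarrow> g \<in> B \<Longrightarrow> f \<circ> g \<in> B"
    and inverse_B: "f \<in> B \<Longrightarrow> \<exists>g\<in>B. f \<circ> g = id \<and> g \<circ> f = id"
    and add_B: "f \<in> B \<Longrightarrow> f (x + y) = f x + f y"
    and orb_eq: "orb n = (\<lambda>f. f n) ` B"
    and reduced: "reduced_index_set orb Z"
begin

section \<open>Orbits and representatives\<close>

lemma minus_B: "f \<in> B \<Longrightarrow> f (x - y) = f x - f y"
  using add_B[of f "x - y" y] by (simp add: algebra_simps)

lemma uminus_B: "f \<in> B \<Longrightarrow> f (- x) = - f x"
  using minus_B[of f 0 0] minus_B[of f 0 x] by simp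

lemma bij_B: "f \<in> B \<Longrightarrow> bij f"
  using inverse_B[of f] o_bij by blast

lemma orb_self: "n \<in> orb n"
  unfolding orb_eq by (rule image_eqI[OF _ id_B]) simp

lemma orb_image: "f \<in> B \<Longrightarrow> f n \<in> orb n"
  by (simp add: orb_eq)

lemma orb_subset:
  assumes "m \<in> orb n"
  shows "orb m \<subseteq> orb n"
proof
  fix k assume "k \<in> orb m"
  then obtain f g where "f \<in> B" "g \<in> B" "k = (g \<circ> f) n"
    using assms by (auto simp: orb_eq)
  then show "k \<in> orb n" using orb_image[OF comp_B] by blast
qed

lemma orb_sym:
  assumes "m \<in> orb n"
  shows "n \<in> orb m"
proof -
  obtain f where "f \<in> B" "m = f n" using assms by (auto simp: orb_eq)
  moreover obtain g where "g \<in> B" "g \<circ> f = id" using inverse_B[OF \<open>f \<in> B\<close>] by blast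
  ultimately have "g \<in> B" "g m = n" by (auto simp: fun_eq_iff)
  then show ?thesis using orb_image by blast
qed

lemma orb_cong: "m \<in> orb n \<Longrightarrow> orb m = orb n"
  using orb_subset orb_sym by blast

lemma orb_uminus: "orb (- n) = uminus ` orb n"
  by (auto simp: orb_eq uminus_B image_image)

lemma finite_orb: "finite (orb n)"
  by (simp add: orb_eq finite_B)

lemma card_orb_pos: "card (orb n) > 0"
  using finite_orb[of n] orb_self[of n] by (auto simp: card_gt_0_iff)

lemma card_orb_le: "card (orb n) \<le> card B"
  by (simp add: orb_eq card_image_le finite_B)

text \<open>Ensures that the orbit operator and its inverse respect conjugate symmetry.\<close>

lemma card_orb_uminus: "card (orb (- n)) = card (orb n)"
  unfolding orb_uminus by (intro card_image) simp

text \<open>Names the choice hidden in \<open>unfolding_seq\<close>, so that uniqueness of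
  representatives is exploited in one place.\<close>

definition rep :: "int^'m \<Rightarrow> int^'m"
  where "rep n = (THE n'. n' \<in> orb n \<inter> Z)"

lemma rep_mem: "rep n \<in> orb n" "rep n \<in> Z"
  using theI'[of "\<lambda>n'. n' \<in> orb n \<inter> Z"] reduced
  by (auto simp: rep_def reduced_index_set_def)

lemma rep_eqI: "m \<in> orb n \<Longrightarrow> m \<in> Z \<Longrightarrow> rep n = m"
  using rep_mem[of n] reduced unfolding reduced_index_set_def by blast

lemma rep_cong: "m \<in> orb n \<Longrightarrow> rep m = rep n"
  by (simp add: rep_def orb_cong)

section \<open>Unfolding and the reduced operations\<close>

lemma unfolding_seq_eq: "unfolding_seq orb Z u n = u (rep n)"
  by (simp add: unfolding_seq_def rep_def)

lemma unfolding_seq_orb: "m \<in> orb n \<Longrightarrow> unfolding_seq orb Z u m = unfolding_seq orb Z u n"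
  by (simp add: unfolding_seq_eq rep_cong)

lemma unfolding_seq_on_Z: "n \<in> Z \<Longrightarrow> unfolding_seq orb Z u n = u n"
  by (simp add: unfolding_seq_eq rep_eqI[OF orb_self])

text \<open>The representative of \<open>n\<close> is an image of \<open>n\<close> under some map in
  \<open>B\<close>, so an invariant sequence is recovered from its values on
  \<open>Z\<close>.\<close>

lemma unfolding_restrict:
  assumes "\<And>f n. f \<in> B \<Longrightarrow> a (f n) = a n"
  shows "unfolding_seq orb Z (restrict_to Z a) = a"
proof
  fix n
  obtain f where "f \<in> B" "rep n = f n" using rep_mem(1)[of n] by (auto simp: orb_eq)
  then show "unfolding_seq orb Z (restrict_to Z a) n = a n"
    using rep_mem(2)[of n] assms[of f n] by (simp add: unfolding_seq_eq restrict_to_def)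
qed

text \<open>Substitute \<open>f k\<close> for \<open>k\<close>, a bijection of the lattice;
  additivity gives \<open>f n - f k = f (n - k)\<close>.\<close>

lemma convolution_invariant:
  assumes f: "f \<in> B" and a: "\<And>n. a (f n) = a n" and b: "\<And>n. b (f n) = b n"
  shows "convolution a b (f n) = convolution a b n"
proof -
  have "convolution a b (f n) = (\<Sum>\<^sub>\<infinity>k. a (f n - f k) * b (f k))"
    unfolding convolution_def by (rule infsum_reindex_bij_betw[OF bij_B[OF f], symmetric])
  also have "\<dots> = convolution a b n"
    unfolding convolution_def minus_B[OF f, symmetric] a b ..
  finally show ?thesis .
qed

text \<open>Convolution preserves invariance, so restricting to \<open>Z\<close> loses nothing and
  the reduced product inherits the estimates of the full lattice.\<close>

lemma unfolding_reduced_conv: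
  "unfolding_seq orb Z (reduced_conv orb Z u v)
    = convolution (unfolding_seq orb Z u) (unfolding_seq orb Z v)"
  unfolding reduced_conv_def
  by (intro unfolding_restrict convolution_invariant) (auto intro: unfolding_seq_orb orb_image)

text \<open>Orbit size is constant along an orbit, so the diagonal operator commutes with
  unfolding.\<close>

lemma unfolding_orbit_op:
  "unfolding_seq orb Z (orbit_op orb u) n = of_nat (card (orb n)) * unfolding_seq orb Z u n"
  by (simp add: unfolding_seq_eq orbit_op_def orb_cong[OF rep_mem(1)])

text \<open>Orbits are finite and nonempty, so \<open>orbit_op\<close> is injective and division by
  the orbit size yields the preimage that \<open>inv_into\<close> must return.\<close>

lemma orbit_op_inv_eq: "orbit_op_inv orb u = (\<lambda>n. u n / of_nat (card (orb n)))"
proof -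
  have ne: "card (orb n) \<noteq> 0" for n using card_orb_pos[of n] by simp
  have "orbit_op_inv orb (orbit_op orb (\<lambda>n. u n / of_nat (card (orb n))))
      = (\<lambda>n. u n / of_nat (card (orb n)))"
    unfolding orbit_op_inv_def
    by (intro inv_into_f_f) (simp_all add: inj_def orbit_op_def fun_eq_iff ne)
  moreover have "orbit_op orb (\<lambda>n. u n / of_nat (card (orb n))) = u"
    by (simp add: orbit_op_def fun_eq_iff ne)
  ultimately show ?thesis by simp
qed

lemma unfolding_orbit_op_inv:
  "unfolding_seq orb Z (orbit_op_inv orb u) n = unfolding_seq orb Z u n / of_nat (card (orb n))"
  by (simp add: unfolding_seq_eq orbit_op_inv_eq orb_cong[OF rep_mem(1)])

section \<open>The reduced weighted spaces\<close>

lemma ell2_iff: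
  "u \<in> ell2 orb Z \<omega> \<longleftrightarrow> (\<forall>n. n \<notin> Z \<longrightarrow> u n = 0) \<and> unfolding_seq orb Z u \<in> weighted_l2 \<omega>"
  by (simp add: ell2_def weighted_l2_def)

lemma ell2_norm_eq: "ell2_norm orb Z \<omega> u = weighted_norm \<omega> (unfolding_seq orb Z u)"
  by (simp add: ell2_norm_def weighted_norm_def)

lemma ell2_unfolding: "u \<in> ell2 orb Z \<omega> \<Longrightarrow> unfolding_seq orb Z u \<in> weighted_l2 \<omega>"
  by (simp add: ell2_iff)

text \<open>Orbit sizes are at most \<open>card B\<close>, which therefore bounds the operator
  norm.\<close>

lemma ell2_orbit_op:
  assumes "u \<in> ell2 orb Z \<omega>"
  shows "orbit_op orb u \<in> ell2 orb Z \<omega>"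
    and "ell2_norm orb Z \<omega> (orbit_op orb u) \<le> real (card B) * ell2_norm orb Z \<omega> u"
proof -
  have b: "cmod (unfolding_seq orb Z (orbit_op orb u) n)
      \<le> real (card B) * cmod (unfolding_seq orb Z u n)" for n
    unfolding unfolding_orbit_op norm_mult using card_orb_le[of n]
    by (intro mult_right_mono) auto
  note * = weighted_l2_dominated[OF weight_nonneg _ ell2_unfolding[OF assms] b]
  show "orbit_op orb u \<in> ell2 orb Z \<omega>"
    using assms *(1) by (simp add: ell2_iff orbit_op_def)
  show "ell2_norm orb Z \<omega> (orbit_op orb u) \<le> real (card B) * ell2_norm orb Z \<omega> u"
    using *(2) by (simp add: ell2_norm_eq)
qed

text \<open>Orbit sizes are at least 1, so dividing by them does not increase any modulus.\<close>

lemma ell2_orbit_op_inv: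
  assumes "u \<in> ell2 orb Z \<omega>"
  shows "orbit_op_inv orb u \<in> ell2 orb Z \<omega>"
proof -
  have "cmod (unfolding_seq orb Z (orbit_op_inv orb u) n) \<le> 1 * cmod (unfolding_seq orb Z u n)" for n
  proof -
    have "cmod (unfolding_seq orb Z u n) * 1 \<le> cmod (unfolding_seq orb Z u n) * real (card (orb n))"
      using card_orb_pos[of n] by (intro mult_left_mono) auto
    then show ?thesis
      using card_orb_pos[of n] by (simp add: unfolding_orbit_op_inv norm_divide divide_le_eq)
  qed
  from weighted_l2_dominated(1)[OF weight_nonneg _ ell2_unfolding[OF assms] this]
  show ?thesis using assms by (simp add: ell2_iff orbit_op_inv_eq)
qed

lemma ell2_reduced_conv:
  "u \<in> ell2 orb Z \<omega> \<Longrightarrow> v \<in> ell2 orb Z \<omega> \<Longrightarrow> reduced_conv orb Z u v \<in> ell2 orb Z \<omega>"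
  by (auto simp: ell2_iff unfolding_reduced_conv convolution_weighted_l2)
    (simp add: reduced_conv_def restrict_to_def)

lemma ell2_real_ell2: "u \<in> ell2_real orb Z \<omega> \<Longrightarrow> u \<in> ell2 orb Z \<omega>"
  by (simp add: ell2_real_def)

lemma ell2_real_uminus:
  "u \<in> ell2_real orb Z \<omega> \<Longrightarrow> unfolding_seq orb Z u (- n) = cnj (unfolding_seq orb Z u n)"
  by (simp add: ell2_real_def)

lemma ell2_real_orbit_op: "u \<in> ell2_real orb Z \<omega> \<Longrightarrow> orbit_op orb u \<in> ell2_real orb Z \<omega>"
  using ell2_orbit_op(1) by (simp add: ell2_real_def unfolding_orbit_op card_orb_uminus)

lemma ell2_real_orbit_op_inv:
  "u \<in> ell2_real orb Z \<omega> \<Longrightarrow> orbit_op_inv orb u \<in> ell2_real orb Z \<omega>"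
  using ell2_orbit_op_inv by (simp add: ell2_real_def unfolding_orbit_op_inv card_orb_uminus)

lemma ell2_real_reduced_conv:
  assumes "u \<in> ell2_real orb Z \<omega>" "v \<in> ell2_real orb Z \<omega>"
  shows "reduced_conv orb Z u v \<in> ell2_real orb Z \<omega>"
  using ell2_reduced_conv[OF assms[THEN ell2_real_ell2]]
    convolution_reflect[of "unfolding_seq orb Z u" "unfolding_seq orb Z v"]
    assms[THEN ell2_real_uminus]
  by (simp add: ell2_real_def unfolding_reduced_conv)

lemma ell2_real_add:
  assumes "u \<in> ell2_real orb Z \<omega>" "v \<in> ell2_real orb Z \<omega>"
  shows "(\<lambda>n. u n + v n) \<in> ell2_real orb Z \<omega>"
proof -
  have eq: "unfolding_seq orb Z (\<lambda>n. u n + v n)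
      = (\<lambda>n. unfolding_seq orb Z u n + unfolding_seq orb Z v n)"
    by (simp add: unfolding_seq_def)
  show ?thesis
    using weighted_l2_add[OF weight_nonneg assms[THEN ell2_real_ell2, THEN ell2_unfolding]]
      assms[THEN ell2_real_ell2] assms[THEN ell2_real_uminus]
    by (simp add: ell2_real_def ell2_iff eq)
qed

lemma reduced_conv_commute: "reduced_conv orb Z u v = reduced_conv orb Z v u"
  by (simp add: reduced_conv_def convolution_commute)

lemma reduced_conv_add_right:
  assumes "u \<in> ell2 orb Z \<omega>" "v \<in> ell2 orb Z \<omega>" "w \<in> ell2 orb Z \<omega>"
  shows "reduced_conv orb Z u (\<lambda>n. v n + w n)
    = (\<lambda>n. reduced_conv orb Z u v n + reduced_conv orb Z u w n)"
  using convolution_add_right[OF assms[THEN ell2_unfolding]]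
  by (simp add: reduced_conv_def restrict_to_def unfolding_seq_def fun_eq_iff)

lemma reduced_conv_cmult_right:
  "reduced_conv orb Z u (\<lambda>n. c * v n) = (\<lambda>n. c * reduced_conv orb Z u v n)"
  using convolution_cmult_right[of "unfolding_seq orb Z u" c "unfolding_seq orb Z v"]
  by (simp add: reduced_conv_def restrict_to_def unfolding_seq_def fun_eq_iff)

section \<open>Orbit sums and the adjoint\<close>

text \<open>The lattice is the disjoint union of the orbits of points of \<open>Z\<close>. Absolute
  summability permits summing orbit by orbit, and each orbit contributes its size times a constant
  value.\<close>

lemma infsum_orbit_representatives:
  fixes f :: "int^'m \<Rightarrow> complex"
  assumes f: "(\<lambda>n. cmod (f n)) summable_on UNIV"
    and inv: "\<And>m n. m \<in> orb n \<Longrightarrow> f m = f n"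
  shows "(\<Sum>\<^sub>\<infinity>n. f n) = (\<Sum>\<^sub>\<infinity>n\<in>Z. of_nat (card (orb n)) * f n)"
proof -
  \<comment> \<open>Disjointness and covering in one statement: each lattice point lies in the orbit
    of exactly one representative.\<close>
  have bij: "bij_betw snd (Sigma Z orb) UNIV"
  proof (rule bij_betwI[where g = "\<lambda>m. (rep m, m)"])
    show "(\<lambda>m. (rep m, m)) \<in> UNIV \<rightarrow> Sigma Z orb"
      using rep_mem orb_sym by auto
  qed (auto simp: rep_eqI orb_sym)
  have "(\<lambda>x. f (snd x)) summable_on Sigma Z orb"
    using Infinite_Sum.abs_summable_summable[OF f] summable_on_reindex_bij_betw[OF bij, of f] by simp
  then have "(\<Sum>\<^sub>\<infinity>n\<in>Z. \<Sum>\<^sub>\<infinity>m\<in>orb n. f m) = (\<Sum>\<^sub>\<infinity>x\<in>Sigma Z orb. f (snd x))"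
    using infsum_Sigma_banach[of "\<lambda>x. f (snd x)" Z orb] by simp
  also have "\<dots> = (\<Sum>\<^sub>\<infinity>n. f n)"
    by (rule infsum_reindex_bij_betw[OF bij])
  finally have "(\<Sum>\<^sub>\<infinity>n. f n) = (\<Sum>\<^sub>\<infinity>n\<in>Z. \<Sum>\<^sub>\<infinity>m\<in>orb n. f m)" ..
  also have "\<dots> = (\<Sum>\<^sub>\<infinity>n\<in>Z. of_nat (card (orb n)) * f n)"
  proof (rule infsum_cong)
    fix n
    have "(\<Sum>m\<in>orb n. f m) = (\<Sum>m\<in>orb n. f n)" by (intro sum.cong refl inv)
    then show "(\<Sum>\<^sub>\<infinity>m\<in>orb n. f m) = of_nat (card (orb n)) * f n"
      by (simp add: finite_orb)
  qed
  finally show ?thesis .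
qed

text \<open>The unfolding is the indicator of the orbit of \<open>n\<close>, hence finitely
  supported. These are the test sequences that determine the adjoint.\<close>

lemma ell2_indicator:
  assumes "n \<in> Z"
  shows "(\<lambda>k. if k = n then 1 else 0) \<in> ell2 orb Z \<omega>"
proof -
  have "unfolding_seq orb Z (\<lambda>k. if k = n then 1 else 0) m = 0" if "m \<notin> orb n" for m
    using that rep_mem(1)[of m] orb_sym by (auto simp: unfolding_seq_eq)
  then have "(\<lambda>m. (cmod (unfolding_seq orb Z (\<lambda>k. if k = n then 1 else 0) m))\<^sup>2 * \<omega> m)
      summable_on UNIV"
    by (intro has_sum_imp_summable[OF has_sum_finite_neutralI[OF finite_orb[of n] _ _ refl]]) auto
  then show ?thesis using assms by (auto simp: ell2_def)
qed

lemma inner2_indicator: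
  assumes "n \<in> Z"
  shows "inner2 Z (\<lambda>k. if k = n then 1 else 0) z = cnj (z n)"
proof -
  have "((\<lambda>k. (if k = n then 1 else 0) * cnj (z k)) has_sum cnj (z n)) Z"
    by (rule has_sum_finite_neutralI[where B = "{n}"]) (use assms in auto)
  then show ?thesis unfolding inner2_def by (rule infsumI)
qed

text \<open>Pass from \<open>Z\<close> to the lattice, move the self-adjoint convolution to the
  other factor, and return to \<open>Z\<close>. The first passage needs an orbit weight, supplied by
  dividing \<open>w\<close>; the return creates the outer \<open>orbit_op\<close>. Only
  \<open>u\<close> has to be conjugate symmetric.\<close>

lemma inner2_mult_op:
  assumes u: "u \<in> ell2_real orb Z \<omega>" and x: "x \<in> ell2 orb Z \<omega>" and w: "w \<in> ell2 orb Z \<omega>"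
  shows "inner2 Z (mult_op orb Z u x) w
    = inner2 Z x (orbit_op orb (reduced_conv orb Z u (orbit_op_inv orb w)))"
proof -
  define a b c where "a = unfolding_seq orb Z u" and "b = unfolding_seq orb Z x"
    and "c = unfolding_seq orb Z (orbit_op_inv orb w)"
  note ell2 = ell2_real_ell2[OF u] x ell2_orbit_op_inv[OF w]
  have abc: "a \<in> weighted_l2 \<omega>" "b \<in> weighted_l2 \<omega>" "c \<in> weighted_l2 \<omega>"
    unfolding a_def b_def c_def by (intro ell2_unfolding ell2)+
  have sym: "a (- n) = cnj (a n)" for n
    unfolding a_def by (rule ell2_real_uminus[OF u])
  obtain K where K: "\<And>n. cmod (c n) \<le> K"
    using weighted_l2_bounded[OF abc(3)] by blast
  obtain M where M: "\<And>n. cmod (b n) \<le> M"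
    using weighted_l2_bounded[OF abc(2)] by blast
  have orb: "a m = a n" "b m = b n" "c m = c n" if "m \<in> orb n" for m n
    unfolding a_def b_def c_def using that by (simp_all add: unfolding_seq_orb)
  have conv_orb: "convolution a b m = convolution a b n" "convolution a c m = convolution a c n"
    if "m \<in> orb n" for m n
  proof -
    obtain f where f: "f \<in> B" "m = f n" using \<open>m \<in> orb n\<close> by (auto simp: orb_eq)
    show "convolution a b m = convolution a b n" "convolution a c m = convolution a c n"
      unfolding f(2) by (intro convolution_invariant f(1) orb orb_image)+
  qed
  have "inner2 Z (mult_op orb Z u x) w
      = (\<Sum>\<^sub>\<infinity>n\<in>Z. of_nat (card (orb n)) * (convolution a b n * cnj (c n)))"
    unfolding inner2_def
  proof (rule infsum_cong)
    \<comment> \<open>The orbit size cancels the division by it inside \<open>c\<close>.\<close>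
    fix n assume "n \<in> Z"
    then show "mult_op orb Z u x n * cnj (w n)
        = of_nat (card (orb n)) * (convolution a b n * cnj (c n))"
      using card_orb_pos[of n]
      by (simp add: mult_op_def reduced_conv_def restrict_to_def a_def b_def c_def
          unfolding_seq_on_Z orbit_op_inv_eq)
  qed
  also have "\<dots> = (\<Sum>\<^sub>\<infinity>n. convolution a b n * cnj (c n))"
    using convolution_self_adjoint(1)[OF abc(1,2)[THEN weighted_l2_abs_summable] sym K]
    by (rule infsum_orbit_representatives[symmetric]) (simp add: orb conv_orb)
  also have "\<dots> = (\<Sum>\<^sub>\<infinity>n. b n * cnj (convolution a c n))"
    by (rule convolution_self_adjoint(2)[OF abc(1,2)[THEN weighted_l2_abs_summable] sym K])
  also have "\<dots> = (\<Sum>\<^sub>\<infinity>n\<in>Z. of_nat (card (orb n)) * (b n * cnj (convolution a c n)))"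
  proof (rule infsum_orbit_representatives)
    have "(\<lambda>n. M * cmod (convolution a c n)) summable_on UNIV"
      using abc by (intro summable_on_cmult_right weighted_l2_abs_summable convolution_weighted_l2)
    then show "(\<lambda>n. cmod (b n * cnj (convolution a c n))) summable_on UNIV"
      by (rule Infinite_Sum.abs_summable_on_comparison_test')
        (auto simp: norm_mult intro!: mult_right_mono M)
  qed (simp add: orb conv_orb)
  also have "\<dots> = inner2 Z x (orbit_op orb (reduced_conv orb Z u (orbit_op_inv orb w)))"
    unfolding inner2_def
    by (rule infsum_cong)
      (simp add: orbit_op_def reduced_conv_def restrict_to_def a_def b_def c_def
        unfolding_seq_on_Z)
  finally show ?thesis .
qed

text \<open>The candidate satisfies the defining identity by \<open>inner2_mult_op\<close>. Testing
  with indicators shows that any other solution agrees with it on \<open>Z\<close>, and off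
  \<open>Z\<close> both vanish.\<close>

lemma adjoint_mult_op:
  assumes u: "u \<in> ell2_real orb Z \<omega>" and w: "w \<in> ell2 orb Z \<omega>"
  shows "adjoint_op orb Z \<omega> (mult_op orb Z u) w
    = orbit_op orb (reduced_conv orb Z u (orbit_op_inv orb w))" (is "_ = ?z")
  unfolding adjoint_op_def
proof (rule the_equality)
  show z: "?z \<in> ell2 orb Z \<omega> \<and>
    (\<forall>x\<in>ell2 orb Z \<omega>. inner2 Z (mult_op orb Z u x) w = inner2 Z x ?z)"
    using inner2_mult_op[OF u _ w]
      ell2_orbit_op(1)[OF ell2_reduced_conv[OF ell2_real_ell2[OF u] ell2_orbit_op_inv[OF w]]]
    by simp
  fix z assume z': "z \<in> ell2 orb Z \<omega> \<and>
    (\<forall>x\<in>ell2 orb Z \<omega>. inner2 Z (mult_op orb Z u x) w = inner2 Z x z)"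
  show "z = ?z"
  proof
    fix n
    show "z n = ?z n"
    proof (cases "n \<in> Z")
      case True
      have "inner2 Z (\<lambda>k. if k = n then 1 else 0) z = inner2 Z (\<lambda>k. if k = n then 1 else 0) ?z"
        using z z' ell2_indicator[OF True] by metis
      then show ?thesis by (simp add: inner2_indicator[OF True])
    next
      case False
      then show ?thesis using z z' by (simp add: ell2_iff)
    qed
  qed
qed

text \<open>On real-valued sequences the map being differentiated coincides with \<open>Q_op orb Z v\<close>, so the
  remainder vanishes identically and only boundedness has to be estimated.\<close>

lemma frechet_derivative_adjoint_mult_op:
  assumes u: "u \<in> ell2_real orb Z \<omega>" and v: "v \<in> ell2_real orb Z \<omega>"
  shows "has_frechet_derivative_on (ell2_real orb Z \<omega>) (ell2_norm orb Z \<omega>)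
    (\<lambda>x. adjoint_op orb Z \<omega> (mult_op orb Z x) v) (Q_op orb Z v) u"
proof -
  let ?X = "ell2_real orb Z \<omega>" and ?N = "ell2_norm orb Z \<omega>" and ?p = "orbit_op_inv orb v"
  let ?F = "\<lambda>x. adjoint_op orb Z \<omega> (mult_op orb Z x) v" and ?D = "Q_op orb Z v"
  have p: "?p \<in> ?X" by (rule ell2_real_orbit_op_inv[OF v])
  have D: "?D h = orbit_op orb (reduced_conv orb Z ?p h)" for h
    by (simp add: Q_op_def mult_op_def)
  \<comment> \<open>Commutativity of convolution turns \<open>x\<close> from the multiplier into the
    argument.\<close>
  have F: "?F x = ?D x" if "x \<in> ?X" for x
    unfolding D adjoint_mult_op[OF that ell2_real_ell2[OF v]]
    by (simp add: reduced_conv_commute)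
  have D_X: "?D h \<in> ?X" if "h \<in> ?X" for h
    unfolding D by (intro ell2_real_orbit_op ell2_real_reduced_conv p that)
  have D_add: "?D (\<lambda>n. h n + k n) = (\<lambda>n. ?D h n + ?D k n)" if "h \<in> ?X" "k \<in> ?X" for h k
    unfolding D reduced_conv_add_right[OF p[THEN ell2_real_ell2] that[THEN ell2_real_ell2]]
    by (simp add: orbit_op_def distrib_left)
  have D_scale: "?D (\<lambda>n. of_real r * h n) = (\<lambda>n. of_real r * ?D h n)" for r h
    unfolding D reduced_conv_cmult_right by (simp add: orbit_op_def mult.left_commute)
  have "\<exists>C. \<forall>h\<in>?X. ?N (?D h) \<le> C * ?N h"
  proof -
    obtain C where C: "C \<ge> 0"
      "\<And>a b. a \<in> weighted_l2 \<omega> \<Longrightarrow> b \<in> weighted_l2 \<omega> \<Longrightarrow> convolution a b \<in> weighted_l2 \<omega> \<and>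
        weighted_norm \<omega> (convolution a b) \<le> C * weighted_norm \<omega> a * weighted_norm \<omega> b"
      using ex_convolution_bound by blast
    \<comment> \<open>The factor \<open>card B\<close> comes from the orbit operator, and
      \<open>C * ?N ?p\<close> from the algebra bound with the fixed factor
      \<open>?p\<close>.\<close>
    have "?N (?D h) \<le> (real (card B) * (C * ?N ?p)) * ?N h" if h: "h \<in> ?X" for h
    proof -
      note h2 = h[THEN ell2_real_ell2] and p2 = p[THEN ell2_real_ell2]
      have "?N (?D h) \<le> real (card B) * ?N (reduced_conv orb Z ?p h)"
        unfolding D by (intro ell2_orbit_op ell2_reduced_conv h2 p2)
      also have "\<dots> \<le> real (card B) * (C * ?N ?p * ?N h)"
        using C(2)[OF ell2_unfolding[OF p2] ell2_unfolding[OF h2]]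
        by (intro mult_left_mono) (auto simp: ell2_norm_eq unfolding_reduced_conv)
      finally show ?thesis by (simp add: mult.assoc)
    qed
    then show ?thesis by blast
  qed
  moreover have "?N (\<lambda>n. ?F (\<lambda>k. u k + h k) n - ?F u n - ?D h n) \<le> \<epsilon> * ?N h"
    if "h \<in> ?X" "\<epsilon> > 0" for h \<epsilon>
  proof -
    have "(\<lambda>n. ?F (\<lambda>k. u k + h k) n - ?F u n - ?D h n) = (\<lambda>n. 0)"
      unfolding F[OF ell2_real_add[OF u that(1)]] F[OF u] D_add[OF u that(1)] by simp
    then show ?thesis
      using that(2) by (simp add: ell2_norm_def unfolding_seq_def weight_nonneg infsum_nonneg)
  qed
  \<comment> \<open>With zero remainder every radius is admissible; 1 is chosen for all
    tolerances.\<close>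
  ultimately show ?thesis
    unfolding has_frechet_derivative_on_def
    using u D_X D_add D_scale by (auto simp: F intro: exI[of _ "1::real"])
qed

end

section \<open>The action on Fourier indices\<close>

lemma matrix_inv_invertible:
  assumes "invertible M"
  shows "M ** matrix_inv M = mat 1" "matrix_inv M ** M = mat 1"
  using someI_ex[OF assms[unfolded invertible_def]] by (simp_all add: matrix_inv_def)

lemma of_int_beta_int:
  assumes "lattice_symmetry G A L" "g \<in> carrier G"
  shows "of_int (beta_int A L g $ i $ j) = beta A L g $ i $ j"
  using assms by (simp add: lattice_symmetry_def beta_int_def of_int_floor)

text \<open>The floors are exact on integral matrices, so a product identity over the reals descends
  entrywise to the integers.\<close>

lemma beta_int_eqI:
  assumes S: "lattice_symmetry G A L" and "g \<in> carrier G" "h \<in> carrier G" "k \<in> carrier G"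
    and "beta A L g = beta A L h ** beta A L k"
  shows "beta_int A L g = beta_int A L h ** beta_int A L k"
proof -
  have "real_of_int (beta_int A L g $ i $ j) = of_int ((beta_int A L h ** beta_int A L k) $ i $ j)"
    for i j
    using assms(2-) by (simp add: of_int_beta_int[OF S] matrix_matrix_mult_def)
  then show ?thesis by (simp add: vec_eq_iff)
qed

text \<open>Transposition reverses products and the inner factors \<open>L ** matrix_inv L\<close>
  cancel, so \<open>beta\<close> is an antihomomorphism.\<close>

lemma beta_mult:
  assumes S: "lattice_symmetry G A L" and g: "g \<in> carrier G" and h: "h \<in> carrier G"
  shows "beta A L (g \<otimes>\<^bsub>G\<^esub> h) = beta A L h ** beta A L g"
proof -
  have L: "L ** matrix_inv L = mat 1"
    using S matrix_inv_invertible(1) by (auto simp: lattice_symmetry_def)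
  have "beta A L h ** beta A L g
      = matrix_inv L ** transpose (A h) ** (L ** matrix_inv L) ** transpose (A g) ** L"
    by (simp add: beta_def matrix_mul_assoc)
  also have "\<dots> = beta A L (g \<otimes>\<^bsub>G\<^esub> h)"
    using S g h by (simp add: L beta_def lattice_symmetry_def matrix_transpose_mul matrix_mul_assoc)
  finally show ?thesis ..
qed

lemma beta_int_mult:
  assumes S: "lattice_symmetry G A L" and g: "g \<in> carrier G" and h: "h \<in> carrier G"
  shows "beta_int A L (g \<otimes>\<^bsub>G\<^esub> h) = beta_int A L h ** beta_int A L g"
proof -
  interpret group G using S by (simp add: lattice_symmetry_def)
  show ?thesis using g h by (intro beta_int_eqI[OF S] beta_mult[OF S]) auto
qed

text \<open>Multiplicativity makes \<open>A\<close> at the unit idempotent, and an orthogonal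
  idempotent matrix is the identity.\<close>

lemma beta_int_one:
  assumes S: "lattice_symmetry G A L"
  shows "beta_int A L \<one>\<^bsub>G\<^esub> = mat 1"
proof -
  interpret group G using S by (simp add: lattice_symmetry_def)
  let ?A = "A \<one>\<^bsub>G\<^esub>"
  have orth: "transpose ?A ** ?A = mat 1" and idem: "?A = ?A ** ?A"
    using S by (auto simp: lattice_symmetry_def orthogonal_matrix_def)
      (metis one_closed r_one)
  have "?A = transpose ?A ** (?A ** ?A)" by (simp add: matrix_mul_assoc orth)
  also have "\<dots> = mat 1" using idem orth by simp
  finally have "beta A L \<one>\<^bsub>G\<^esub> = matrix_inv L ** L"
    by (simp add: beta_def transpose_mat)
  also have "\<dots> = mat 1"
    using S matrix_inv_invertible(2) by (auto simp: lattice_symmetry_def)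
  finally show ?thesis
    by (simp add: beta_int_def mat_def vec_eq_iff)
qed

lemma orbit_action_lattice_symmetry:
  assumes S: "lattice_symmetry G A L" and "admissible_weights \<omega>"
    and "reduced_index_set (index_orbit G A L) Z"
  shows "orbit_action \<omega> ((\<lambda>g. (*v) (beta_int A L g)) ` carrier G) (index_orbit G A L) Z"
proof -
  interpret group G using S by (simp add: lattice_symmetry_def)
  let ?b = "\<lambda>g. (*v) (beta_int A L g)"
  \<comment> \<open>The order reversal of \<open>beta_int\<close> is harmless: the composite is
    still the map of a group element.\<close>
  have comp: "?b h \<circ> ?b g = ?b (g \<otimes>\<^bsub>G\<^esub> h)" if "g \<in> carrier G" "h \<in> carrier G" for g h
    using that by (simp add: fun_eq_iff beta_int_mult[OF S] matrix_vector_mul_assoc)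
  have one: "?b \<one>\<^bsub>G\<^esub> = id"
    by (simp add: fun_eq_iff beta_int_one[OF S])
  show ?thesis
  proof
    show "admissible_weights \<omega>" "reduced_index_set (index_orbit G A L) Z" by fact+
    show "finite (?b ` carrier G)" using S by (simp add: lattice_symmetry_def)
    show "id \<in> ?b ` carrier G" using one by (metis one_closed imageI)
    show "f \<circ> g \<in> ?b ` carrier G" if "f \<in> ?b ` carrier G" "g \<in> ?b ` carrier G" for f g
      using that comp by auto
    show "\<exists>g\<in>?b ` carrier G. f \<circ> g = id \<and> g \<circ> f = id" if "f \<in> ?b ` carrier G" for f
    proof -
      obtain g where g: "g \<in> carrier G" "f = ?b g" using \<open>f \<in> ?b ` carrier G\<close> by blast
      then have "f \<circ> ?b (inv\<^bsub>G\<^esub> g) = id" "?b (inv\<^bsub>G\<^esub> g) \<circ> f = id"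
        by (simp_all add: comp one)
      then show ?thesis using g by blast
    qed
    show "f (x + y) = f x + f y" if "f \<in> ?b ` carrier G" for f x y
      using that by (auto simp: matrix_vector_right_distrib)
    show "index_orbit G A L n = (\<lambda>f. f n) ` ?b ` carrier G" for n
      by (auto simp: index_orbit_def)
  qed
qed

theorem proposition2p1:
  fixes G :: "('g, 'b) monoid_scheme"
    and A :: "'g \<Rightarrow> real^'m^'m"
    and L :: "real^'m^'m"
    and Z :: "(int^'m) set"
    and \<omega> :: "int^'m \<Rightarrow> real"
    and u v :: "int^'m \<Rightarrow> complex"
  defines "orb \<equiv> index_orbit G A L"
  assumes "lattice_symmetry G A L"
    and "reduced_index_set orb Z"
    and "admissible_weights \<omega>"
    and "u \<in> ell2_real orb Z \<omega>"
    and "v \<in> ell2_real orb Z \<omega>"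
  shows "(\<forall>w \<in> ell2 orb Z \<omega>.
            adjoint_op orb Z \<omega> (mult_op orb Z u) w =
            (orbit_op orb \<circ> mult_op orb Z u \<circ> orbit_op_inv orb) w) \<and>
         adjoint_op orb Z \<omega> (mult_op orb Z u) v =
            orbit_op orb (reduced_conv orb Z u (orbit_op_inv orb v)) \<and>
         has_frechet_derivative_on (ell2_real orb Z \<omega>) (ell2_norm orb Z \<omega>)
            (\<lambda>x. adjoint_op orb Z \<omega> (mult_op orb Z x) v) (Q_op orb Z v) u \<and>
         Q_op orb Z u v =
            orbit_op orb (reduced_conv orb Z (orbit_op_inv orb u) v)"
proof -
  interpret orbit_action \<omega> "(\<lambda>g. (*v) (beta_int A L g)) ` carrier G" orb Z
    unfolding orb_def using assms(2-4) by (intro orbit_action_lattice_symmetry) (simp_all add: orb_def)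
  \<comment> \<open>The first two claims are the adjoint formula at \<open>w\<close> and at
    \<open>v\<close>; the last unfolds \<open>Q_op\<close>.\<close>
  show ?thesis
    using adjoint_mult_op[OF assms(5)] ell2_real_ell2[OF assms(6)]
      frechet_derivative_adjoint_mult_op[OF assms(5,6)]
    by (auto simp: mult_op_def Q_op_def)
qed

end
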